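(* Let $G$ be a finite simple connected graph with $m\geq 1$ edges. (i) If $G\ncong P_{m+1}$, then $SDD(\mathcal{L}(G))\geq 2m$, with equality if and only if $G\cong S_4$ or $G\cong C_m$. (ii) If $G\ncong K_2$, then $$SDD(\mathcal{L}(G))\leq \left(\frac{1}{2}M_{1}(G)-m\right)\left(m-1+\frac{1}{m-1}\right),$$ with equality if and only if $G\cong P_3$ or $G\cong P_4$.
   Context: For a finite simple graph $H$ with vertex set $V_H$ and edge set $E_H$, $d_u$ denotes the degree of vertex $u$ in $H$; the symmetric division deg index is $SDD(H)=\sum_{uv\in E_H}\left(\frac{d_u}{d_v}+\frac{d_v}{d_u}\right)$ and the first Zagreb index is $M_1(H)=\sum_{u\in V_H}d_u^2$. The line graph $\mathcal{L}(G)$ has vertex set $E_G$, two vertices being adjacent when the corresponding edges of $G$ share a common endpoint. $P_k$, $C_k$, $S_k$, $K_k$ denote the path, cycle, star and complete graph on $k$ vertices (cycles require $k\ge 3$). *)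

theory Defs
  imports Complex_Main
begin

datatype 'a sgraph = SGraph (verts: "'a set") (edges: "'a set set")

definition simple_graph :: "'a sgraph \<Rightarrow> bool" where
  "simple_graph G \<longleftrightarrow> (\<forall>e\<in>edges G. e \<subseteq> verts G \<and> card e = 2)"

definition finite_simple_graph :: "'a sgraph \<Rightarrow> bool" where
  "finite_simple_graph G \<longleftrightarrow> finite (verts G) \<and> simple_graph G"

definition adj_rel :: "'a sgraph \<Rightarrow> ('a \<times> 'a) set" where
  "adj_rel G = {(u, v). {u, v} \<in> edges G}"

definition connected_graph :: "'a sgraph \<Rightarrow> bool" where
  "connected_graph G \<longleftrightarrow>
     verts G \<noteq> {} \<and> (\<forall>u\<in>verts G. \<forall>v\<in>verts G. (u, v) \<in> (adj_rel G)\<^sup>*)"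

definition graph_iso :: "'a sgraph \<Rightarrow> 'b sgraph \<Rightarrow> bool"  (infix "\<simeq>" 50) where
  "G \<simeq> H \<longleftrightarrow>
     (\<exists>f. bij_betw f (verts G) (verts H) \<and>
          (\<forall>u\<in>verts G. \<forall>v\<in>verts G. {u, v} \<in> edges G \<longleftrightarrow> {f u, f v} \<in> edges H))"

definition degree :: "'a sgraph \<Rightarrow> 'a \<Rightarrow> nat" where
  "degree G v = card {e \<in> edges G. v \<in> e}"

text \<open>The two inner sums range over both orderings of the endpoints of the edge \<open>e\<close>, so an
  edge \<open>uv\<close> contributes \<open>d\<^sub>u / d\<^sub>v + d\<^sub>v / d\<^sub>u\<close>; see the lemma \<open>SDD_summand\<close> below.\<close>
definition SDD :: "'a sgraph \<Rightarrow> real" where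
  "SDD G = (\<Sum>e\<in>edges G. \<Sum>u\<in>e. \<Sum>v\<in>e - {u}. real (degree G u) / real (degree G v))"

lemma SDD_summand:
  assumes "u \<noteq> v"
  shows "(\<Sum>x\<in>{u, v}. \<Sum>y\<in>{u, v} - {x}. real (degree G x) / real (degree G y)) =
    real (degree G u) / real (degree G v) + real (degree G v) / real (degree G u)"
proof -
  have "{u, v} - {u} = {v}" "{u, v} - {v} = {u}" using assms by auto
  then show ?thesis using assms by simp
qed

definition first_Zagreb :: "'a sgraph \<Rightarrow> real" where
  "first_Zagreb G = (\<Sum>u\<in>verts G. (real (degree G u))\<^sup>2)"

definition line_graph :: "'a sgraph \<Rightarrow> 'a set sgraph" where
  "line_graph G =
     SGraph (edges G) {{e, f} | e f. e \<in> edges G \<and> f \<in> edges G \<and> e \<noteq> f \<and> e \<inter> f \<noteq> {}}"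

text \<open>In the following the index is the number of vertices.\<close>

definition path_graph :: "nat \<Rightarrow> nat sgraph" where
  "path_graph k = SGraph {..<k} {{i, i + 1} | i. i + 1 < k}"

text \<open>This is a cycle only for \<open>k \<ge> 3\<close>.\<close>
definition cycle_graph :: "nat \<Rightarrow> nat sgraph" where
  "cycle_graph k = SGraph {..<k} {{i, (i + 1) mod k} | i. i < k}"

definition star_graph :: "nat \<Rightarrow> nat sgraph" where
  "star_graph k = SGraph {..<k} {{0, i} | i. 0 < i \<and> i < k}"

definition complete_graph :: "nat \<Rightarrow> nat sgraph" where
  "complete_graph k = SGraph {..<k} {{i, j} | i j. i < k \<and> j < k \<and> i \<noteq> j}"

end

theory Submission
  imports Defs
begin

text \<open>An edge \<open>uv\<close> of \<open>G\<close> has degree \<open>d\<^sub>u + d\<^sub>v - 2\<close> in the line graph \<open>L\<close>, so the handshake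
  lemma for \<open>L\<close> gives \<open>|E(L)| = M\<^sub>1 / 2 - m\<close>.

  Lower bound: \<open>SDD L \<ge> 2 |E(L)|\<close>, since \<open>x / y + y / x \<ge> 2\<close>. If all degrees of \<open>G\<close> are at most 2,
  then \<open>G\<close> is a path or a cycle; otherwise
  \<open>|E(L)| - m = (\<Sum>v. (d\<^sub>v - 1) (d\<^sub>v - 2) / 2) + m - n \<ge> 0\<close>, because the sum is at least 1 and a connected
  graph has \<open>m \<ge> n - 1\<close>. Equality forces \<open>L\<close> to be 2-regular, and then a vertex of degree at least 3
  has degree exactly 3 and only leaves as neighbours.

  Upper bound: degrees in \<open>L\<close> lie between 1 and \<open>M = m - 1\<close>, where \<open>x / y + y / x \<le> M + 1 / M\<close> with
  equality only for \<open>{x, y} = {1, M}\<close>. Equality therefore gives every edge of \<open>L\<close> an endpoint of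
  degree 1; a vertex of degree at least 3 in \<open>G\<close>, a cycle, or a path with at least four edges
  violates this.\<close>

section \<open>Edges, endpoints and degree sums\<close>

lemma finite_edges: "finite_simple_graph G \<Longrightarrow> finite (edges G)"
  unfolding finite_simple_graph_def simple_graph_def
  by (rule finite_subset[of _ "Pow (verts G)"]) auto

lemma edgeE:
  assumes "simple_graph G" "e \<in> edges G" "u \<in> e"
  obtains v where "e = {u, v}" "u \<noteq> v" "u \<in> verts G" "v \<in> verts G"
proof -
  have "card e = 2" "e \<subseteq> verts G" using assms by (auto simp: simple_graph_def)
  then obtain a b where "e = {a, b}" "a \<noteq> b" by (meson card_2_iff)
  then have "u = a \<or> u = b" using assms(3) by auto
  then show thesis
    using that[of a] that[of b] \<open>e = {a, b}\<close> \<open>a \<noteq> b\<close> \<open>e \<subseteq> verts G\<close>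
    by (metis insert_commute insert_subset)
qed

lemma edge_ne: "simple_graph G \<Longrightarrow> {u, v} \<in> edges G \<Longrightarrow> u \<noteq> v"
  by (auto simp: simple_graph_def)

lemma edges_share_two_vertices:
  assumes "simple_graph G" "e \<in> edges G" "f \<in> edges G" "u \<in> e" "v \<in> e" "u \<in> f" "v \<in> f" "u \<noteq> v"
  shows "e = f"
  using assms by (metis edgeE insertE singletonD)

text \<open>Double counting of incident pairs (v, e). The weight 1 gives the handshake lemma, the
  weight \<open>degree G\<close> gives the sum of squared degrees.\<close>

lemma sum_edges_endpoints:
  fixes f :: "'a \<Rightarrow> nat"
  assumes "finite_simple_graph G"
  shows "(\<Sum>e\<in>edges G. \<Sum>v\<in>e. f v) = (\<Sum>v\<in>verts G. degree G v * f v)"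
proof -
  have sub: "e \<subseteq> verts G" if "e \<in> edges G" for e
    using assms that by (auto simp: finite_simple_graph_def simple_graph_def)
  have fin: "finite (verts G)" using assms by (simp add: finite_simple_graph_def)
  \<comment> \<open>Each edge is rewritten as a filtered subset of the fixed set
    \<open>verts G\<close>, the shape in which \<open>sum.swap_restrict\<close> exchanges the
    sums.\<close>
  have "(\<Sum>e\<in>edges G. \<Sum>v\<in>e. f v) = (\<Sum>e\<in>edges G. \<Sum>v\<in>{v\<in>verts G. v \<in> e}. f v)"
    by (intro sum.cong refl) (use sub in auto)
  also have "\<dots> = (\<Sum>v\<in>verts G. \<Sum>e\<in>{e\<in>edges G. v \<in> e}. f v)"
    using fin finite_edges[OF assms] by (rule sum.swap_restrict[OF _ _ , rotated])
  finally show ?thesis by (simp add: degree_def)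
qed

lemma handshake:
  assumes "finite_simple_graph G"
  shows "(\<Sum>v\<in>verts G. degree G v) = 2 * card (edges G)"
proof -
  have "(\<Sum>e\<in>edges G. \<Sum>v\<in>e. 1::nat) = (\<Sum>e\<in>edges G. 2)"
    using assms by (intro sum.cong refl) (auto simp: finite_simple_graph_def simple_graph_def)
  then show ?thesis using sum_edges_endpoints[OF assms, of "\<lambda>_. 1"] by simp
qed

section \<open>Degrees and edge count of the line graph\<close>

lemma verts_line_graph [simp]: "verts (line_graph G) = edges G"
  by (simp add: line_graph_def)

lemma line_graph_edge_iff:
  "{e, f} \<in> edges (line_graph G) \<longleftrightarrow> e \<in> edges G \<and> f \<in> edges G \<and> e \<noteq> f \<and> e \<inter> f \<noteq> {}"
  by (fastforce simp: line_graph_def doubleton_eq_iff)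

lemma line_graph_edgeE:
  assumes "E \<in> edges (line_graph G)"
  obtains e f where "E = {e, f}" "e \<in> edges G" "f \<in> edges G" "e \<noteq> f" "e \<inter> f \<noteq> {}"
  using assms by (auto simp: line_graph_def)

lemma finite_simple_line_graph:
  assumes "finite_simple_graph G"
  shows "finite_simple_graph (line_graph G)"
  using finite_edges[OF assms]
  by (auto simp: finite_simple_graph_def simple_graph_def line_graph_def card_insert_if)

text \<open>The map sending f to {e, f} is a bijection from the edges meeting e onto the line graph
  edges at e.\<close>

lemma degree_line_graph_card:
  assumes "e \<in> edges G"
  shows "degree (line_graph G) e = card {f \<in> edges G. f \<noteq> e \<and> e \<inter> f \<noteq> {}}"
proof -
  have "{E \<in> edges (line_graph G). e \<in> E} = (\<lambda>f. {e, f}) ` {f \<in> edges G. f \<noteq> e \<and> e \<inter> f \<noteq> {}}"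
  proof (intro equalityI subsetI)
    fix E assume E: "E \<in> {E \<in> edges (line_graph G). e \<in> E}"
    then have "E \<in> edges (line_graph G)" by simp
    then obtain f g where "E = {f, g}" "f \<in> edges G" "g \<in> edges G" "f \<noteq> g" "f \<inter> g \<noteq> {}"
      by (rule line_graph_edgeE)
    with E show "E \<in> (\<lambda>f. {e, f}) ` {f \<in> edges G. f \<noteq> e \<and> e \<inter> f \<noteq> {}}"
      by (cases "e = f") (auto simp: insert_commute Int_commute)
  next
    fix E assume "E \<in> (\<lambda>f. {e, f}) ` {f \<in> edges G. f \<noteq> e \<and> e \<inter> f \<noteq> {}}"
    then obtain f where "f \<in> edges G" "f \<noteq> e" "e \<inter> f \<noteq> {}" "E = {e, f}" by blast
    then show "E \<in> {E \<in> edges (line_graph G). e \<in> E}"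
      using assms by (simp add: line_graph_edge_iff)
  qed
  moreover have "inj_on (\<lambda>f. {e, f}) {f \<in> edges G. f \<noteq> e \<and> e \<inter> f \<noteq> {}}"
    by (auto simp: inj_on_def doubleton_eq_iff)
  ultimately show ?thesis by (simp add: degree_def card_image)
qed

text \<open>The neighbours of uv are the other edges at u together with the other edges at v. The
  edge uv itself is counted in both degrees, which is the 2; written additively, no truncated
  subtraction occurs.\<close>

lemma degree_line_graph:
  assumes "finite_simple_graph G" "{u, v} \<in> edges G"
  shows "degree (line_graph G) {u, v} + 2 = degree G u + degree G v"
proof -
  have sg: "simple_graph G" and fin: "finite (edges G)"
    using assms finite_edges by (auto simp: finite_simple_graph_def)
  let ?A = "\<lambda>x. {f \<in> edges G. x \<in> f}"
  have ne: "u \<noteq> v" using edge_ne[OF sg assms(2)] .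
  have "{f \<in> edges G. f \<noteq> {u, v} \<and> {u, v} \<inter> f \<noteq> {}} = (?A u - {{u, v}}) \<union> (?A v - {{u, v}})"
    by auto
  \<comment> \<open>An edge through both u and v is uv, because the graph is simple.\<close>
  moreover have "(?A u - {{u, v}}) \<inter> (?A v - {{u, v}}) = {}"
    using edges_share_two_vertices[OF sg _ assms(2), of _ u v] ne by auto
  ultimately have "degree (line_graph G) {u, v} = card (?A u - {{u, v}}) + card (?A v - {{u, v}})"
    using fin by (simp add: degree_line_graph_card[OF assms(2)] card_Un_disjoint)
  moreover have "card (?A u) = Suc (card (?A u - {{u, v}}))" "card (?A v) = Suc (card (?A v - {{u, v}}))"
    by (rule card.remove; use fin assms in auto)+
  ultimately show ?thesis by (simp add: degree_def)
qed

text \<open>Double counting turns the sum of squared degrees into the sum of d_u + d_v over the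
  edges uv. Each such term is a line graph degree plus 2, and the handshake lemma for the line graph
  finishes.\<close>

lemma card_edges_line_graph:
  assumes "finite_simple_graph G"
  shows "(\<Sum>v\<in>verts G. (degree G v)\<^sup>2) = 2 * card (edges (line_graph G)) + 2 * card (edges G)"
proof -
  have sg: "simple_graph G" using assms by (simp add: finite_simple_graph_def)
  have "(\<Sum>v\<in>verts G. (degree G v)\<^sup>2) = (\<Sum>e\<in>edges G. \<Sum>v\<in>e. degree G v)"
    by (simp add: sum_edges_endpoints[OF assms] power2_eq_square)
  also have "\<dots> = (\<Sum>e\<in>edges G. degree (line_graph G) e + 2)"
  proof (rule sum.cong[OF refl])
    fix e assume e: "e \<in> edges G"
    then obtain u v where uv: "e = {u, v}" "u \<noteq> v"
      using sg by (metis card_2_iff simple_graph_def)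
    then show "(\<Sum>v\<in>e. degree G v) = degree (line_graph G) e + 2"
      using degree_line_graph[OF assms, of u v] e by simp
  qed
  also have "\<dots> = 2 * card (edges (line_graph G)) + 2 * card (edges G)"
    using handshake[OF finite_simple_line_graph[OF assms]]
    by (simp only: sum.distrib verts_line_graph) simp
  finally show ?thesis .
qed

section \<open>Consequences of connectedness\<close>

text \<open>The working form of connectedness: a set closed under adjacency absorbs everything
  reachable from one of its members.\<close>

lemma connected_closed_set:
  assumes "connected_graph G" "simple_graph G" "x \<in> S" "x \<in> verts G"
    and closed: "\<And>u v. u \<in> S \<Longrightarrow> {u, v} \<in> edges G \<Longrightarrow> v \<in> S"
  shows "verts G \<subseteq> S"
proof
  fix y assume "y \<in> verts G"
  then have "(x, y) \<in> (adj_rel G)\<^sup>*" using assms by (simp add: connected_graph_def)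
  then show "y \<in> S"
    by (induction rule: rtrancl_induct) (use assms in \<open>auto simp: adj_rel_def\<close>)
qed

lemma Union_edges:
  assumes "connected_graph G" "simple_graph G" "edges G \<noteq> {}"
  shows "\<Union>(edges G) = verts G"
proof
  show "\<Union>(edges G) \<subseteq> verts G" using assms by (auto simp: simple_graph_def)
  obtain e where e: "e \<in> edges G" using assms by auto
  then obtain x where "x \<in> e" using assms by (metis card.empty equals0I simple_graph_def zero_neq_numeral)
  then have "x \<in> \<Union>(edges G)" "x \<in> verts G" using e assms by (auto simp: simple_graph_def)
  then show "verts G \<subseteq> \<Union>(edges G)"
    by (rule connected_closed_set[OF assms(1,2)]) auto
qed

text \<open>Connectedness of the line graph as an induction rule. The vertices lying on some edge
  with property P form a set closed under adjacency, since any edge through such a vertex either is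
  that edge or meets it.\<close>

lemma connected_edges_induct:
  assumes "connected_graph G" "simple_graph G" "e0 \<in> edges G" "P e0"
    and step: "\<And>e f. e \<in> edges G \<Longrightarrow> f \<in> edges G \<Longrightarrow> e \<noteq> f \<Longrightarrow> e \<inter> f \<noteq> {} \<Longrightarrow> P e \<Longrightarrow> P f"
    and "e \<in> edges G"
  shows "P e"
proof -
  let ?S = "{v. \<exists>e\<in>edges G. v \<in> e \<and> P e}"
  have step': "P f" if "v \<in> ?S" "f \<in> edges G" "v \<in> f" for v f
    using that step by blast
  obtain x where x: "x \<in> e0" "x \<in> verts G"
    using assms(2,3) by (metis card.empty equals0I simple_graph_def subsetD zero_neq_numeral)
  have "verts G \<subseteq> ?S"
    by (rule connected_closed_set[OF assms(1,2), of x]) (use x assms step' in blast)+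
  moreover obtain y where "y \<in> e" "y \<in> verts G"
    using assms(2,6) by (metis card.empty equals0I simple_graph_def subsetD zero_neq_numeral)
  ultimately show ?thesis using step' assms(6) by blast
qed

text \<open>A vertex set is grown one vertex at a time; each new vertex brings an edge back to the
  earlier ones.\<close>

lemma connected_card_verts_le:
  assumes "connected_graph G" "finite_simple_graph G"
  shows "card (verts G) \<le> card (edges G) + 1"
proof -
  have sg: "simple_graph G" and fin: "finite (verts G)"
    using assms by (auto simp: finite_simple_graph_def)
  have "\<exists>S. S \<subseteq> verts G \<and> card S = Suc k \<and> k \<le> card {e \<in> edges G. e \<subseteq> S}"
    if "k < card (verts G)" for k
    using that
  proof (induction k)
    case 0
    then obtain x where "x \<in> verts G" by fastforce
    then show ?case by (intro exI[of _ "{x}"]) auto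
  next
    case (Suc k)
    then obtain S where S: "S \<subseteq> verts G" "card S = Suc k" "k \<le> card {e \<in> edges G. e \<subseteq> S}" by auto
    have finS: "finite S" using S fin finite_subset by blast
    \<comment> \<open>Being nonempty and too small, S cannot be closed under adjacency, so some edge
      uv leaves it. That edge is not among those inside S, hence the count rises by one.\<close>
    have "\<not> verts G \<subseteq> S" using S Suc.prems by (metis less_irrefl subset_antisym)
    moreover obtain x where "x \<in> S" using S by fastforce
    ultimately obtain u v where uv: "u \<in> S" "{u, v} \<in> edges G" "v \<notin> S"
      using connected_closed_set[OF assms(1) sg, of x S] S by blast
    have "v \<in> verts G" using uv sg by (auto simp: simple_graph_def)
    have "Suc k \<le> card (insert {u, v} {e \<in> edges G. e \<subseteq> S})"
      using S uv finite_edges[OF assms(2)] by simp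
    also have "\<dots> \<le> card {e \<in> edges G. e \<subseteq> insert v S}"
      by (rule card_mono) (use uv finite_edges[OF assms(2)] in auto)
    finally show ?case
      using S uv \<open>v \<in> verts G\<close> finS by (intro exI[of _ "insert v S"]) auto
  qed
  moreover have "card (verts G) > 0"
    using assms fin by (auto simp: connected_graph_def card_gt_0_iff)
  ultimately obtain S where "card (verts G) - 1 \<le> card {e \<in> edges G. e \<subseteq> S}"
    by (metis diff_less zero_less_one)
  also have "\<dots> \<le> card (edges G)"
    by (rule card_mono) (use finite_edges[OF assms(2)] in auto)
  finally show ?thesis by simp
qed

section \<open>Isomorphism as an injective image\<close>

text \<open>The map g is the inverse of the isomorphism. It goes from the concrete graph H to G, so
  the edge set of G is an explicit image, from which degrees and edge counts can be read
  off.\<close>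

lemma graph_iso_iff_image:
  assumes "simple_graph G" "simple_graph H"
  shows "G \<simeq> H \<longleftrightarrow>
    (\<exists>g. inj_on g (verts H) \<and> verts G = g ` verts H \<and> edges G = (`) g ` edges H)"
proof
  assume "G \<simeq> H"
  then obtain f where f: "bij_betw f (verts G) (verts H)"
    "\<And>u v. u \<in> verts G \<Longrightarrow> v \<in> verts G \<Longrightarrow> {u, v} \<in> edges G \<longleftrightarrow> {f u, f v} \<in> edges H"
    by (auto simp: graph_iso_def)
  let ?g = "inv_into (verts G) f"
  have g: "bij_betw ?g (verts H) (verts G)" using f(1) by (rule bij_betw_inv_into)
  have fg: "f (?g x) = x" "?g x \<in> verts G" if "x \<in> verts H" for x
    using that f(1) g by (auto simp: bij_betw_inv_into_right bij_betwE)
  have gf: "?g (f x) = x" "f x \<in> verts H" if "x \<in> verts G" for x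
    using that f(1) by (auto simp: bij_betw_inv_into_left bij_betwE)
  have "edges G = (`) ?g ` edges H"
  proof (intro equalityI subsetI)
    fix e assume e: "e \<in> edges G"
    then obtain u v where uv: "e = {u, v}" "u \<in> verts G" "v \<in> verts G"
      using assms(1) by (metis card_2_iff insert_subset simple_graph_def)
    then have "{f u, f v} \<in> edges H" "?g ` {f u, f v} = e" using e f gf by auto
    then show "e \<in> (`) ?g ` edges H" by blast
  next
    fix e assume "e \<in> (`) ?g ` edges H"
    then obtain e' where e': "e' \<in> edges H" "e = ?g ` e'" by auto
    then obtain u v where uv: "e' = {u, v}" "u \<in> verts H" "v \<in> verts H"
      using assms(2) by (metis card_2_iff insert_subset simple_graph_def)
    then show "e \<in> edges G" using e' fg f(2)[of "?g u" "?g v"] by auto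
  qed
  then show "\<exists>g. inj_on g (verts H) \<and> verts G = g ` verts H \<and> edges G = (`) g ` edges H"
    using g by (intro exI[of _ ?g]) (auto simp: bij_betw_def)
next
  assume "\<exists>g. inj_on g (verts H) \<and> verts G = g ` verts H \<and> edges G = (`) g ` edges H"
  then obtain g where g: "inj_on g (verts H)" "verts G = g ` verts H" "edges G = (`) g ` edges H" by auto
  let ?f = "inv_into (verts H) g"
  have gbij: "bij_betw g (verts H) (verts G)" using g by (auto simp: bij_betw_def)
  have "{g x, g y} \<in> edges G \<longleftrightarrow> {x, y} \<in> edges H" if "x \<in> verts H" "y \<in> verts H" for x y
  proof -
    have "{g x, g y} = g ` {x, y}" by simp
    moreover have "g ` {x, y} \<in> (`) g ` edges H \<longleftrightarrow> {x, y} \<in> edges H"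
      by (rule inj_on_image_mem_iff[OF inj_on_image_Pow[OF g(1)]])
         (use that assms(2) in \<open>auto simp: simple_graph_def\<close>)
    ultimately show ?thesis using g(3) by simp
  qed
  then have "{u, v} \<in> edges G \<longleftrightarrow> {?f u, ?f v} \<in> edges H" if "u \<in> verts G" "v \<in> verts G" for u v
    using that g by (metis f_inv_into_f inv_into_into)
  then show "G \<simeq> H"
    unfolding graph_iso_def using bij_betw_inv_into[OF gbij] by blast
qed

lemma image_graph_degree:
  assumes "simple_graph H" "inj_on g (verts H)" "edges G = (`) g ` edges H" "v \<in> verts H"
  shows "degree G (g v) = degree H v"
proof -
  have "{e \<in> edges G. g v \<in> e} = (`) g ` {e \<in> edges H. v \<in> e}"
    using assms by (auto simp: simple_graph_def dest: inj_onD)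
  moreover have "inj_on ((`) g) {e \<in> edges H. v \<in> e}"
    by (rule inj_on_subset[OF inj_on_image_Pow[OF assms(2)]]) (use assms(1) in \<open>auto simp: simple_graph_def\<close>)
  ultimately show ?thesis by (simp add: degree_def card_image)
qed

lemma image_graph_card_edges:
  assumes "simple_graph H" "inj_on g (verts H)" "edges G = (`) g ` edges H"
  shows "card (edges G) = card (edges H)"
  unfolding assms(3)
  by (rule card_image, rule inj_on_subset[OF inj_on_image_Pow[OF assms(2)]])
     (use assms(1) in \<open>auto simp: simple_graph_def\<close>)

section \<open>Concrete paths, cycles and the star on four vertices\<close>

lemma simple_path_graph: "simple_graph (path_graph k)"
  by (auto simp: simple_graph_def path_graph_def)

lemma simple_star_graph: "simple_graph (star_graph k)"
  by (auto simp: simple_graph_def star_graph_def)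

text \<open>Splitting off the wrap-around index k - 1 reduces facts about the cycle to facts about
  the path.\<close>

lemma cycle_graph_edges:
  assumes "k \<ge> 1"
  shows "edges (cycle_graph k) = insert {k - 1, 0} (edges (path_graph k))"
proof -
  have "{i. i < k} = insert (k - 1) {i. i + 1 < k}" using assms by auto
  then have "(\<lambda>i. {i, (i + 1) mod k}) ` {i. i < k} =
      insert {k - 1, 0} ((\<lambda>i. {i, (i + 1) mod k}) ` {i. i + 1 < k})"
    using assms by simp
  also have "(\<lambda>i. {i, (i + 1) mod k}) ` {i. i + 1 < k} = (\<lambda>i. {i, i + 1}) ` {i. i + 1 < k}"
    by (rule image_cong) auto
  finally show ?thesis
    by (simp add: cycle_graph_def path_graph_def setcompr_eq_image)
qed

lemma verts_cycle_graph [simp]: "verts (cycle_graph k) = {..<k}"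
  by (simp add: cycle_graph_def)

lemma verts_path_graph [simp]: "verts (path_graph k) = {..<k}"
  by (simp add: path_graph_def)

lemma simple_cycle_graph: "k \<ge> 3 \<Longrightarrow> simple_graph (cycle_graph k)"
  using simple_path_graph[of k] by (auto simp: simple_graph_def cycle_graph_edges)

lemma edges_path_graph: "edges (path_graph k) = (\<lambda>i. {i, i + 1}) ` {..<k - 1}"
  by (auto simp: path_graph_def)

lemma card_edges_path_graph: "card (edges (path_graph k)) = k - 1"
proof -
  have "inj_on (\<lambda>i::nat. {i, i + 1}) {..<k - 1}"
    by (auto simp: inj_on_def doubleton_eq_iff)
  then show ?thesis by (simp add: edges_path_graph card_image)
qed

lemma degree_path_graph_inner:
  assumes "0 < i" "i + 1 < k"
  shows "degree (path_graph k) i = 2"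
proof -
  have "{e \<in> edges (path_graph k). i \<in> e} = {{i - 1, i}, {i, i + 1}}"
    using assms by (force simp: path_graph_def)
  moreover have "{i - 1, i} \<noteq> {i, i + 1}" using assms by (auto simp: doubleton_eq_iff)
  ultimately show ?thesis by (simp add: degree_def)
qed

lemma degree_path_graph_0:
  assumes "k \<ge> 2"
  shows "degree (path_graph k) 0 = 1"
proof -
  have "{e \<in> edges (path_graph k). 0 \<in> e} = {{0, 1}}"
    using assms by (force simp: path_graph_def)
  then show ?thesis by (simp add: degree_def)
qed

lemma degree_path_graph_last:
  assumes "k \<ge> 2"
  shows "degree (path_graph k) (k - 1) = 1"
proof -
  have "{e \<in> edges (path_graph k). k - 1 \<in> e} = {{k - 2, k - 1}}"
    using assms by (force simp: path_graph_def)
  then show ?thesis by (simp add: degree_def)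
qed

text \<open>For k at least 3 the closing edge is not a path edge, so it raises the degree of each
  path end from 1 to 2 and changes no other degree.\<close>

lemma degree_cycle_graph:
  assumes "k \<ge> 3" "i < k"
  shows "degree (cycle_graph k) i = 2"
proof -
  have fin: "finite (edges (path_graph k))"
    by (rule finite_edges) (simp add: finite_simple_graph_def simple_path_graph)
  have notin: "{k - 1, 0} \<notin> edges (path_graph k)"
    using assms by (auto simp: path_graph_def doubleton_eq_iff)
  have "{e \<in> edges (cycle_graph k). i \<in> e} =
    (if i = 0 \<or> i = k - 1 then insert {k - 1, 0} {e \<in> edges (path_graph k). i \<in> e}
     else {e \<in> edges (path_graph k). i \<in> e})"
    using assms by (auto simp: cycle_graph_edges)
  then have "degree (cycle_graph k) i =
    (if i = 0 \<or> i = k - 1 then Suc (degree (path_graph k) i) else degree (path_graph k) i)"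
    using fin notin by (simp add: degree_def)
  then show ?thesis
    using assms degree_path_graph_inner[of i k] degree_path_graph_0[of k] degree_path_graph_last[of k]
    by auto
qed

lemma edges_star_graph_4: "edges (star_graph 4) = {{0, 1}, {0, 2}, {0, 3}}"
proof -
  have "{i::nat. 0 < i \<and> i < 4} = {1, 2, 3}" by auto
  then have "(\<lambda>i. {0, i}) ` {i::nat. 0 < i \<and> i < 4} = {{0, 1}, {0, 2}, {0, 3}}" by simp
  then show ?thesis by (simp add: star_graph_def setcompr_eq_image)
qed

section \<open>Bounds for x / y + y / x and for the index\<close>

lemma sum_ratio_ge_2:
  fixes x y :: real
  assumes "x > 0" "y > 0"
  shows "x / y + y / x \<ge> 2" and "x / y + y / x = 2 \<longleftrightarrow> x = y"
proof -
  have "x / y + y / x - 2 = (x - y)\<^sup>2 / (x * y)"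
    using assms by (simp add: field_simps power2_eq_square)
  moreover have "(x - y)\<^sup>2 / (x * y) \<ge> 0" using assms by simp
  moreover have "(x - y)\<^sup>2 / (x * y) = 0 \<longleftrightarrow> x = y" using assms by simp
  ultimately show "x / y + y / x \<ge> 2" "x / y + y / x = 2 \<longleftrightarrow> x = y" by linarith+
qed

text \<open>The gap factors as (M y - x) (M x - y) / (M x y), with both factors nonnegative on the
  given range. A factor vanishes only when one variable is M and the other is 1.\<close>

lemma sum_ratio_le:
  fixes x y M :: real
  assumes "1 \<le> x" "x \<le> M" "1 \<le> y" "y \<le> M"
  shows "x / y + y / x \<le> M + 1 / M"
    and "x / y + y / x = M + 1 / M \<longleftrightarrow> x = 1 \<and> y = M \<or> x = M \<and> y = 1"
proof -
  have id: "M + 1 / M - (x / y + y / x) = (M * y - x) * (M * x - y) / (M * x * y)"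
    using assms by (simp add: field_simps)
  have xy: "x \<le> M * y" "y \<le> M * x"
    using assms mult_mono[of x M 1 y] mult_mono[of y M 1 x] by auto
  show "x / y + y / x \<le> M + 1 / M"
  proof -
    have "(M * y - x) * (M * x - y) / (M * x * y) \<ge> 0" using assms xy by simp
    then show ?thesis using id by linarith
  qed
  have eq: "a = M \<and> b = 1" if "M * b = a" "a \<le> M" "1 \<le> b" "M \<ge> 1" for a b
  proof -
    have "b \<le> 1" using that mult_le_cancel_left_pos[of M b 1] by simp
    with that show ?thesis by simp
  qed
  have "x / y + y / x = M + 1 / M \<longleftrightarrow> (M * y - x) * (M * x - y) / (M * x * y) = 0"
    using id by linarith
  also have "\<dots> \<longleftrightarrow> M * y = x \<or> M * x = y" using assms by auto
  also have "\<dots> \<longleftrightarrow> x = 1 \<and> y = M \<or> x = M \<and> y = 1"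
    using assms eq[of y x] eq[of x y] by auto
  finally show "x / y + y / x = M + 1 / M \<longleftrightarrow> x = 1 \<and> y = M \<or> x = M \<and> y = 1" .
qed

lemma degree_pos:
  assumes "finite_simple_graph G" "e \<in> edges G" "v \<in> e"
  shows "degree G v \<ge> 1"
proof -
  have "finite {e \<in> edges G. v \<in> e}" "{e \<in> edges G. v \<in> e} \<noteq> {}"
    using assms finite_edges[OF assms(1)] by auto
  then show ?thesis by (simp add: degree_def Suc_le_eq card_gt_0_iff)
qed

lemma degree_le_card_edges: "finite_simple_graph G \<Longrightarrow> degree G v \<le> card (edges G)"
  unfolding degree_def by (rule card_mono) (use finite_edges in auto)

text \<open>The gap is the sum of the nonnegative terms \<open>c - s e\<close>, which vanishes only
  termwise. Both bounds on the index and their equality cases come from here.\<close>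

lemma sum_le_const:
  fixes s :: "'b \<Rightarrow> real"
  assumes "finite A" "\<And>e. e \<in> A \<Longrightarrow> s e \<le> c"
  shows "sum s A \<le> real (card A) * c" "sum s A = real (card A) * c \<longleftrightarrow> (\<forall>e\<in>A. s e = c)"
proof -
  have eq: "real (card A) * c - sum s A = (\<Sum>e\<in>A. c - s e)" by (simp add: sum_subtractf)
  moreover have "(\<Sum>e\<in>A. c - s e) \<ge> 0" using assms by (intro sum_nonneg) auto
  ultimately show "sum s A \<le> real (card A) * c" by linarith
  have "(\<Sum>e\<in>A. c - s e) = 0 \<longleftrightarrow> (\<forall>e\<in>A. c - s e = 0)"
    using assms by (intro sum_nonneg_eq_0_iff) auto
  moreover have "sum s A = real (card A) * c \<longleftrightarrow> (\<Sum>e\<in>A. c - s e) = 0"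
    using eq by linarith
  ultimately show "sum s A = real (card A) * c \<longleftrightarrow> (\<forall>e\<in>A. s e = c)"
    by (simp add: eq_commute[of c])
qed

lemma SDD_ge:
  assumes "finite_simple_graph H"
  shows "SDD H \<ge> 2 * real (card (edges H))"
    and "SDD H = 2 * real (card (edges H)) \<longleftrightarrow>
      (\<forall>u v. {u, v} \<in> edges H \<longrightarrow> degree H u = degree H v)"
proof -
  have sg: "simple_graph H" using assms by (simp add: finite_simple_graph_def)
  let ?s = "\<lambda>e. \<Sum>u\<in>e. \<Sum>v\<in>e - {u}. real (degree H u) / real (degree H v)"
  have s: "?s {u, v} \<ge> 2" "?s {u, v} = 2 \<longleftrightarrow> degree H u = degree H v" if "{u, v} \<in> edges H" for u v
  proof -
    have "u \<noteq> v" using edge_ne[OF sg that] .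
    moreover have "degree H u \<ge> 1" "degree H v \<ge> 1" using degree_pos[OF assms that] by auto
    ultimately show "?s {u, v} \<ge> 2" "?s {u, v} = 2 \<longleftrightarrow> degree H u = degree H v"
      using sum_ratio_ge_2[of "real (degree H u)" "real (degree H v)"]
      unfolding SDD_summand[OF \<open>u \<noteq> v\<close>] by auto
  qed
  have ex: "\<exists>u v. e = {u, v}" if "e \<in> edges H" for e
    using that sg by (metis card_2_iff simple_graph_def)
  \<comment> \<open>Signs are reversed because \<open>sum_le_const\<close> bounds from
    above.\<close>
  have neg: "SDD H = - (\<Sum>e\<in>edges H. - ?s e)" by (simp add: SDD_def sum_negf)
  have le: "- ?s e \<le> - 2" if "e \<in> edges H" for e using s(1) ex that by fastforce
  note c = sum_le_const[of "edges H" "\<lambda>e. - ?s e", OF finite_edges[OF assms] le]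
  show "SDD H \<ge> 2 * real (card (edges H))" using c(1) neg by linarith
  have "SDD H = 2 * real (card (edges H)) \<longleftrightarrow> (\<forall>e\<in>edges H. - ?s e = - 2)"
    using c(2) neg by linarith
  also have "\<dots> \<longleftrightarrow> (\<forall>u v. {u, v} \<in> edges H \<longrightarrow> degree H u = degree H v)"
  proof
    assume *: "\<forall>e\<in>edges H. - ?s e = - 2"
    show "\<forall>u v. {u, v} \<in> edges H \<longrightarrow> degree H u = degree H v"
    proof (intro allI impI)
      fix u v assume e: "{u, v} \<in> edges H"
      then show "degree H u = degree H v" using * s(2)[OF e] by fastforce
    qed
  next
    assume *: "\<forall>u v. {u, v} \<in> edges H \<longrightarrow> degree H u = degree H v"
    show "\<forall>e\<in>edges H. - ?s e = - 2"
    proof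
      fix e assume e: "e \<in> edges H"
      then obtain u v where uv: "e = {u, v}" using ex by blast
      with e have "?s {u, v} = 2" using * s(2)[of u v] by blast
      then show "- ?s e = - 2" unfolding uv by (rule arg_cong)
    qed
  qed
  finally show "SDD H = 2 * real (card (edges H)) \<longleftrightarrow>
      (\<forall>u v. {u, v} \<in> edges H \<longrightarrow> degree H u = degree H v)" .
qed

text \<open>The ends of an edge have degrees between 1 and M, so \<open>sum_ratio_le\<close> applies
  to each summand. For the line graph M will be m - 1.\<close>

lemma SDD_le:
  assumes "finite_simple_graph H" "\<And>v. v \<in> verts H \<Longrightarrow> degree H v \<le> M"
  shows "SDD H \<le> real (card (edges H)) * (real M + 1 / real M)"
    and "SDD H = real (card (edges H)) * (real M + 1 / real M) \<longleftrightarrow>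
      (\<forall>u v. {u, v} \<in> edges H \<longrightarrow>
        degree H u = 1 \<and> degree H v = M \<or> degree H u = M \<and> degree H v = 1)"
proof -
  have sg: "simple_graph H" using assms by (simp add: finite_simple_graph_def)
  let ?s = "\<lambda>e. \<Sum>u\<in>e. \<Sum>v\<in>e - {u}. real (degree H u) / real (degree H v)"
  let ?Q = "\<lambda>u v. degree H u = 1 \<and> degree H v = M \<or> degree H u = M \<and> degree H v = 1"
  have s: "?s {u, v} \<le> real M + 1 / real M" "?s {u, v} = real M + 1 / real M \<longleftrightarrow> ?Q u v"
    if "{u, v} \<in> edges H" for u v
  proof -
    have "u \<noteq> v" using edge_ne[OF sg that] .
    moreover have "degree H u \<ge> 1" "degree H v \<ge> 1" using degree_pos[OF assms(1) that] by auto
    moreover have "degree H u \<le> M" "degree H v \<le> M"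
      using assms(2) sg that by (auto simp: simple_graph_def)
    ultimately show "?s {u, v} \<le> real M + 1 / real M" "?s {u, v} = real M + 1 / real M \<longleftrightarrow> ?Q u v"
      using sum_ratio_le[of "real (degree H u)" "real M" "real (degree H v)"]
      unfolding SDD_summand[OF \<open>u \<noteq> v\<close>] by auto
  qed
  have ex: "\<exists>u v. e = {u, v}" if "e \<in> edges H" for e
    using that sg by (metis card_2_iff simple_graph_def)
  have le: "?s e \<le> real M + 1 / real M" if "e \<in> edges H" for e using s(1) ex that by fastforce
  note c = sum_le_const[of "edges H" ?s, OF finite_edges[OF assms(1)] le]
  show "SDD H \<le> real (card (edges H)) * (real M + 1 / real M)" using c(1) by (simp add: SDD_def)
  have "SDD H = real (card (edges H)) * (real M + 1 / real M) \<longleftrightarrow>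
      (\<forall>e\<in>edges H. ?s e = real M + 1 / real M)"
    using c(2) by (simp add: SDD_def)
  also have "\<dots> \<longleftrightarrow> (\<forall>u v. {u, v} \<in> edges H \<longrightarrow> ?Q u v)"
  proof
    assume *: "\<forall>e\<in>edges H. ?s e = real M + 1 / real M"
    show "\<forall>u v. {u, v} \<in> edges H \<longrightarrow> ?Q u v"
    proof (intro allI impI)
      fix u v assume e: "{u, v} \<in> edges H"
      show "?Q u v" using bspec[OF * e] unfolding s(2)[OF e] .
    qed
  next
    assume *: "\<forall>u v. {u, v} \<in> edges H \<longrightarrow> ?Q u v"
    show "\<forall>e\<in>edges H. ?s e = real M + 1 / real M"
    proof
      fix e assume e: "e \<in> edges H"
      then obtain u v where uv: "e = {u, v}" using ex by blast
      with e have e': "{u, v} \<in> edges H" by simp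
      with * have "?Q u v" by blast
      then show "?s e = real M + 1 / real M" unfolding uv s(2)[OF e'] .
    qed
  qed
  finally show "SDD H = real (card (edges H)) * (real M + 1 / real M) \<longleftrightarrow>
      (\<forall>u v. {u, v} \<in> edges H \<longrightarrow> ?Q u v)" .
qed

section \<open>Connected graphs of maximum degree at most two\<close>

text \<open>Otherwise va, vb, vc would be three different edges at v.\<close>

lemma degree_le_2_neighbours:
  assumes "finite_simple_graph G" "degree G v \<le> 2"
    and "{v, a} \<in> edges G" "{v, b} \<in> edges G" "{v, c} \<in> edges G" "a \<noteq> b"
  shows "c = a \<or> c = b"
proof (rule ccontr)
  assume c: "\<not> (c = a \<or> c = b)"
  have "v \<noteq> a" "v \<noteq> b" "v \<noteq> c"
    using assms edge_ne[of G v] by (simp_all add: finite_simple_graph_def)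
  then have "card {{v, a}, {v, b}, {v, c}} = 3"
    using assms(6) c by (auto simp: doubleton_eq_iff card_insert_if)
  moreover have "card {{v, a}, {v, b}, {v, c}} \<le> degree G v"
    unfolding degree_def by (rule card_mono) (use assms finite_edges[OF assms(1)] in auto)
  ultimately show False using assms(2) by simp
qed

lemma max_degree_2_path_or_cycle:
  assumes "connected_graph G" "finite_simple_graph G" "edges G \<noteq> {}"
    and deg: "\<And>v. v \<in> verts G \<Longrightarrow> degree G v \<le> 2"
  defines "m \<equiv> card (edges G)"
  shows "G \<simeq> path_graph (m + 1) \<or> m \<ge> 3 \<and> G \<simeq> cycle_graph m"
proof -
  have sg: "simple_graph G" and fin: "finite (verts G)"
    using assms(2) by (auto simp: finite_simple_graph_def)
  have inV: "u \<in> verts G" "v \<in> verts G" if "{u, v} \<in> edges G" for u v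
    using that sg by (auto simp: simple_graph_def)
  \<comment> \<open>Take a longest path \<open>g 0, \<dots>, g (k - 1)\<close>: no edge leaves it, and the only possible chord
    joins its two ends.\<close>
  define W where "W k g \<longleftrightarrow> inj_on g {..<k} \<and> (\<forall>i. i + 1 < k \<longrightarrow> {g i, g (i + 1)} \<in> edges G)"
    for k and g :: "nat \<Rightarrow> 'a"
  have WE: "{g i, g (Suc i)} \<in> edges G" if "W k g" "Suc i < k" for g k i
    using that by (auto simp: W_def)
  \<comment> \<open>With at least two vertices on the path, each \<open>g i\<close> lies on an edge;
    \<open>W 1 g\<close> would allow \<open>g 0\<close> to lie outside the graph.\<close>
  have W_sub: "g ` {..<k} \<subseteq> verts G" if "W k g" "k \<ge> 2" for k g
  proof
    fix x assume "x \<in> g ` {..<k}"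
    then obtain i where i: "x = g i" "i < k" by auto
    show "x \<in> verts G"
    proof (cases "Suc i < k")
      case True
      then show ?thesis using WE[OF that(1)] inV i by blast
    next
      case False
      then have "i = Suc (i - 1)" "Suc (i - 1) < k" using i that by auto
      then show ?thesis using WE[OF that(1), of "i - 1"] inV i by metis
    qed
  qed
  define P where "P k \<longleftrightarrow> k \<ge> 2 \<and> (\<exists>g. W k g)" for k
  obtain u v where uv: "{u, v} \<in> edges G"
    using assms(3) sg by (metis card_2_iff ex_in_conv simple_graph_def)
  have "W 2 (\<lambda>i. if i = 0 then u else v)"
    using uv edge_ne[OF sg uv] by (auto simp: W_def inj_on_def)
  then have P2: "P 2" by (auto simp: P_def)
  \<comment> \<open>A path is injective, so its length is bounded; this makes the
    \<open>GREATEST\<close> below meaningful.\<close>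
  have bound: "\<forall>k. P k \<longrightarrow> k \<le> card (verts G)"
  proof (intro allI impI)
    fix k assume "P k"
    then obtain g where g: "W k g" "k \<ge> 2" by (auto simp: P_def)
    then show "k \<le> card (verts G)"
      using card_mono[OF fin W_sub[OF g]] by (simp add: W_def card_image)
  qed
  define k where "k = (GREATEST k. P k)"
  have "P k" unfolding k_def by (rule GreatestI_nat[of P 2, OF P2]) (use bound in blast)
  moreover have max: "\<not> P (Suc k)"
  proof
    assume "P (Suc k)"
    then have "Suc k \<le> k" unfolding k_def by (rule Greatest_le_nat[of P]) (use bound in blast)
    then show False by simp
  qed
  ultimately obtain g where g: "W k g" and k2: "k \<ge> 2" by (auto simp: P_def)
  have inner: "c = g (i - 1) \<or> c = g (i + 1)"
    if W: "W k g" and i: "0 < i" "i + 1 < k" and c: "{g i, c} \<in> edges G" for g i c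
  proof (rule degree_le_2_neighbours[OF assms(2) deg _ _ c])
    show "g i \<in> verts G" using inV c by blast
    show "{g i, g (i - 1)} \<in> edges G"
      using WE[OF W, of "i - 1"] i by (simp add: insert_commute)
    show "{g i, g (i + 1)} \<in> edges G" using WE[OF W, of i] i by simp
    show "g (i - 1) \<noteq> g (i + 1)" using W i by (auto simp: W_def dest!: inj_onD)
  qed
  have last: "c = g (k - 2) \<or> c = g 0" if W: "W k g" and c: "{g (k - 1), c} \<in> edges G" for g c
  proof -
    have "c \<in> g ` {..<k}"
    proof (rule ccontr)
      \<comment> \<open>Appending c would give a path on k + 1 vertices, against maximality.\<close>
      assume c': "c \<notin> g ` {..<k}"
      let ?h = "g(k := c)"
      have "inj_on ?h {..<Suc k}"
        using W c' by (auto simp: W_def inj_on_def less_Suc_eq)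
      moreover have "{?h i, ?h (i + 1)} \<in> edges G" if "i + 1 < Suc k" for i
      proof (cases "i + 1 = k")
        case True
        then have "i = k - 1" "i \<noteq> k" by auto
        then show ?thesis using c True by simp
      next
        case False
        then show ?thesis using WE[OF W, of i] that by simp
      qed
      ultimately have "W (Suc k) ?h" by (simp add: W_def)
      then show False using max k2 by (auto simp: P_def)
    qed
    then obtain j where j: "c = g j" "j < k" by auto
    have "j \<noteq> k - 1" using c j edge_ne[OF sg c] by auto
    then have j': "j + 1 < k" using j by auto
    show ?thesis
    proof (cases "j = 0")
      case False
      \<comment> \<open>Seen from the inner vertex \<open>g j\<close>, the last vertex must be one
        of its two path neighbours; injectivity then leaves only j = k - 2.\<close>
      have "{g j, g (k - 1)} \<in> edges G" using c j by (simp add: insert_commute)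
      from inner[OF W _ j' this] False have "g (k - 1) = g (j - 1) \<or> g (k - 1) = g (j + 1)" by simp
      moreover have "inj_on g {..<k}" using W by (simp add: W_def)
      ultimately have "k - 1 = j - 1 \<or> k - 1 = j + 1"
        using j' by (auto dest!: inj_onD)
      then have "j = k - 2" using j' False by auto
      then show ?thesis using j by simp
    qed (use j in simp)
  qed
  have first: "c = g 1 \<or> c = g (k - 1)" if c: "{g 0, c} \<in> edges G" for c
  proof -
    \<comment> \<open>The reversed path is again a path on k vertices, so \<open>last\<close>
      applies to its final vertex \<open>g 0\<close>.\<close>
    let ?h = "\<lambda>i. g (k - 1 - i)"
    have "W k ?h"
      unfolding W_def
    proof (intro conjI allI impI)
      show "inj_on ?h {..<k}"
      proof (rule inj_onI)
        fix x y assume xy: "x \<in> {..<k}" "y \<in> {..<k}" "?h x = ?h y"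
        then have "k - 1 - x = k - 1 - y"
          using g by (intro inj_onD[of g "{..<k}"]) (auto simp: W_def)
        then show "x = y" using xy by auto
      qed
    next
      fix i assume i: "i + 1 < k"
      then have "Suc (k - 1 - (i + 1)) = k - 1 - i" by auto
      then show "{?h i, ?h (i + 1)} \<in> edges G"
        using WE[OF g, of "k - 1 - (i + 1)"] i by (simp add: insert_commute)
    qed
    from last[OF this, of c] c k2 show ?thesis by simp
  qed
  have nbr: "(\<exists>j. j + 1 < k \<and> {g i, c} = {g j, g (j + 1)}) \<or> {g i, c} = {g (k - 1), g 0}"
    if i: "i < k" and c: "{g i, c} \<in> edges G" for i c
  proof -
    consider "i = 0" | "i = k - 1" | "0 < i" "i + 1 < k" using i by linarith
    then show ?thesis
    proof cases
      case 1
      then have "{g i, c} = {g 0, g (0 + 1)} \<or> {g i, c} = {g (k - 1), g 0}"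
        using first c by auto
      then show ?thesis using k2 by (metis One_nat_def Suc_le_eq add_0 numeral_2_eq_2)
    next
      case 2
      then have "{g i, c} = {g (k - 2), g (k - 2 + 1)} \<or> {g i, c} = {g (k - 1), g 0}"
        using last[OF g, of c] c k2 by (auto simp: Suc_diff_le numeral_2_eq_2 Suc_diff_Suc)
      moreover have "k - 2 + 1 < k" using k2 by simp
      ultimately show ?thesis by blast
    next
      case 3
      then have "{g i, c} = {g (i - 1), g (i - 1 + 1)} \<or> {g i, c} = {g i, g (i + 1)}"
        using inner[OF g, of i c] c by auto
      moreover have "i - 1 + 1 < k" using 3 by simp
      ultimately show ?thesis using 3 by blast
    qed
  qed
  \<comment> \<open>By \<open>nbr\<close> no edge leads out of the path, so connectedness leaves no
    further vertex.\<close>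
  have "verts G \<subseteq> g ` {..<k}"
  proof (rule connected_closed_set[OF assms(1) sg, of "g 0"])
    show "g 0 \<in> verts G" using W_sub[OF g k2] k2 by auto
    fix u v assume "u \<in> g ` {..<k}" and e: "{u, v} \<in> edges G"
    then obtain i where i: "i < k" "u = g i" by auto
    have "{u, v} \<subseteq> g ` {..<k}"
      using nbr[OF i(1)] e i(2) k2 by fastforce
    then show "v \<in> g ` {..<k}" by simp
  qed (use k2 in auto)
  then have verts: "verts G = g ` {..<k}" using W_sub[OF g k2] by blast
  have inj: "inj_on g {..<k}" using g by (simp add: W_def)
  let ?P = "(`) g ` edges (path_graph k)"
  have Peq: "?P = (\<lambda>j. {g j, g (j + 1)}) ` {..<k - 1}"
    by (simp add: edges_path_graph image_image)
  have P_sub: "?P \<subseteq> edges G" using WE[OF g] by (auto simp: Peq)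
  have sub: "edges G \<subseteq> insert {g (k - 1), g 0} ?P"
  proof
    fix e assume e: "e \<in> edges G"
    then obtain u v where "e = {u, v}" "u \<in> verts G" 
      using sg by (metis card_2_iff insert_subset simple_graph_def)
    then obtain i where "e = {g i, v}" "i < k" using verts by auto
    with nbr[of i v] e have "(\<exists>j. j + 1 < k \<and> e = {g j, g (j + 1)}) \<or> e = {g (k - 1), g 0}" by simp
    then show "e \<in> insert {g (k - 1), g 0} ?P" by (auto simp: Peq)
  qed
  show ?thesis
  \<comment> \<open>For k = 2 the closing edge is the path edge itself, hence the additional
    condition that k be at least 3.\<close>
  proof (cases "{g (k - 1), g 0} \<in> edges G \<and> k \<ge> 3")
    case True
    have E: "edges G = (`) g ` edges (cycle_graph k)"
      using P_sub sub True by (auto simp: cycle_graph_edges)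
    have iso: "G \<simeq> cycle_graph k"
      using graph_iso_iff_image[OF sg simple_cycle_graph] True inj verts E by auto
    \<comment> \<open>The edges of the cycle are counted by the handshake lemma: all k degrees are
      2, so m = k.\<close>
    have "2 * card (edges G) = (\<Sum>v\<in>g ` {..<k}. degree G v)"
      using handshake[OF assms(2)] verts by simp
    also have "\<dots> = (\<Sum>i<k. degree G (g i))" using inj by (simp add: sum.reindex)
    also have "\<dots> = (\<Sum>i<k. 2)"
      by (rule sum.cong)
         (use image_graph_degree[OF simple_cycle_graph _ E] degree_cycle_graph True inj in auto)
    finally have "m = k" by (simp add: m_def)
    then show ?thesis using iso True by simp
  next
    case False
    have E: "edges G = ?P"
    proof (cases "{g (k - 1), g 0} \<in> edges G")
      case True
      then have "k = 2" using False k2 by auto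
      then have "{g (k - 1), g 0} \<in> ?P" unfolding Peq by (simp add: insert_commute)
      then have "edges G \<subseteq> ?P" using sub by (simp only: insert_absorb)
      then show ?thesis using P_sub by (rule subset_antisym)
    next
      case False
      have "edges G \<subseteq> ?P" using sub unfolding subset_insert[OF False] .
      then show ?thesis using P_sub by (rule subset_antisym)
    qed
    have "m = k - 1"
      using image_graph_card_edges[OF simple_path_graph _ E] inj
      by (simp only: card_edges_path_graph m_def verts_path_graph)
    then have "m + 1 = k" using k2 by simp
    then show ?thesis
      using graph_iso_iff_image[OF sg simple_path_graph[of k]] inj verts E by auto
  qed
qed

section \<open>The lower bound and its equality case\<close>

lemma card_edges_le_line_graph:
  assumes "connected_graph G" "finite_simple_graph G" "w \<in> verts G" "degree G w \<ge> 3"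
  shows "card (edges G) \<le> card (edges (line_graph G))"
proof -
  let ?d = "\<lambda>v. int (degree G v)"
  have fin: "finite (verts G)" using assms by (simp add: finite_simple_graph_def)
  \<comment> \<open>A product of consecutive integers is never negative. Working in
    \<open>int\<close> keeps the subtractions honest.\<close>
  have nn: "(d - 1) * (d - 2) \<ge> 0" for d :: int
    by (cases "d \<ge> 2") (auto intro: mult_nonneg_nonneg mult_nonpos_nonpos)
  have "2 \<le> (?d w - 1) * (?d w - 2)"
    using assms(4) mult_mono[of 2 "?d w - 1" 1 "?d w - 2"] by simp
  also have "\<dots> \<le> (\<Sum>v\<in>verts G. (?d v - 1) * (?d v - 2))"
    by (rule member_le_sum) (use nn assms fin in auto)
  also have "\<dots> = (\<Sum>v\<in>verts G. (?d v)\<^sup>2 - 3 * ?d v + 2)"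
    by (intro sum.cong refl) (simp add: algebra_simps power2_eq_square)
  also have "\<dots> = int (\<Sum>v\<in>verts G. (degree G v)\<^sup>2) - 3 * int (\<Sum>v\<in>verts G. degree G v)
      + 2 * int (card (verts G))"
    by (simp add: sum.distrib sum_subtractf sum_distrib_left)
  \<comment> \<open>With n vertices this reads 2 \<le> 2 |E(L)| - 4 m + 2 n. Inserting n \<le> m +
    1, the two constants cancel exactly.\<close>
  finally show ?thesis
    using card_edges_line_graph[OF assms(2)] handshake[OF assms(2)]
      connected_card_verts_le[OF assms(1,2)] by simp
qed

text \<open>The handshake lemma gives as many edges as vertices in the line graph, and equal degrees
  reach equality in \<open>SDD_ge\<close>. Both extremal families of the lower bound are handled
  this way.\<close>

lemma line_graph_2_regular:
  assumes "finite_simple_graph G" "\<And>e. e \<in> edges G \<Longrightarrow> degree (line_graph G) e = 2"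
  shows "card (edges (line_graph G)) = card (edges G)"
    and "SDD (line_graph G) = 2 * real (card (edges G))"
proof -
  show c: "card (edges (line_graph G)) = card (edges G)"
    using handshake[OF finite_simple_line_graph[OF assms(1)]] assms(2) by simp
  show "SDD (line_graph G) = 2 * real (card (edges G))"
    using SDD_ge(2)[OF finite_simple_line_graph[OF assms(1)]] assms(2)
    by (simp add: c line_graph_edge_iff)
qed

lemma cycle_line_graph_degree:
  assumes "finite_simple_graph G" "k \<ge> 3" "G \<simeq> cycle_graph k" "e \<in> edges G"
  shows "degree (line_graph G) e = 2"
proof -
  have sg: "simple_graph G" using assms by (simp add: finite_simple_graph_def)
  obtain g where g: "inj_on g (verts (cycle_graph k))" "verts G = g ` verts (cycle_graph k)"
    "edges G = (`) g ` edges (cycle_graph k)"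
    using graph_iso_iff_image[OF sg simple_cycle_graph] assms by blast
  have "degree G v = 2" if "v \<in> verts G" for v
    using that g(2) image_graph_degree[OF simple_cycle_graph g(1,3)] assms degree_cycle_graph by auto
  moreover obtain u v where "e = {u, v}" "u \<in> verts G" "v \<in> verts G"
    using assms(4) sg by (metis card_2_iff insert_subset simple_graph_def)
  ultimately show ?thesis using degree_line_graph[OF assms(1), of u v] assms(4) by simp
qed

text \<open>Any two of the three edges meet in the centre, so the line graph is a triangle.\<close>

lemma star_4_line_graph_degree:
  assumes "finite_simple_graph G" "G \<simeq> star_graph 4" "e \<in> edges G"
  shows "degree (line_graph G) e = 2"
proof -
  have sg: "simple_graph G" using assms by (simp add: finite_simple_graph_def)
  obtain g where g: "inj_on g (verts (star_graph 4))" "verts G = g ` verts (star_graph 4)"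
    "edges G = (`) g ` edges (star_graph 4)"
    using graph_iso_iff_image[OF sg simple_star_graph] assms by blast
  have E: "edges G = {{g 0, g 1}, {g 0, g 2}, {g 0, g 3}}"
    using g(3) by (simp add: edges_star_graph_4)
  have inj: "g i = g j \<longleftrightarrow> i = j" if "i < 4" "j < 4" for i j
    using g(1) that by (auto simp: star_graph_def dest: inj_onD)
  have "{f \<in> edges G. f \<noteq> e \<and> e \<inter> f \<noteq> {}} = edges G - {e}"
    using assms(3) by (auto simp: E)
  moreover have "card (edges G) = 3"
    by (simp add: E card_insert_if doubleton_eq_iff inj)
  ultimately show ?thesis
    using assms(3) finite_edges[OF assms(1)] by (simp add: degree_line_graph_card)
qed

lemma star_4_if_line_graph_2_regular:
  assumes "connected_graph G" "finite_simple_graph G" "w \<in> verts G" "degree G w \<ge> 3"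
    and reg: "\<And>e. e \<in> edges G \<Longrightarrow> degree (line_graph G) e = 2"
  shows "G \<simeq> star_graph 4"
proof -
  have sg: "simple_graph G" and fin: "finite (edges G)"
    using assms(2) finite_edges by (auto simp: finite_simple_graph_def)
  have nbr: "degree G w = 3 \<and> degree G x = 1" if "{w, x} \<in> edges G" for x
  proof -
    \<comment> \<open>With the degree of w at least 3 and that of x at least 1, only 3 + 1
      remains.\<close>
    have "degree G w + degree G x = 4"
      using degree_line_graph[OF assms(2) that] reg[OF that] by simp
    then show ?thesis using degree_pos[OF assms(2) that, of x] assms(4) by auto
  qed
  have "{e \<in> edges G. w \<in> e} \<noteq> {}"
    using assms(4) unfolding degree_def by (metis card.empty not_numeral_le_zero)
  then obtain e0 where e0: "e0 \<in> edges G" "w \<in> e0" by blast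
  have all: "w \<in> e" if "e \<in> edges G" for e
  proof (rule connected_edges_induct[where P = "\<lambda>e. w \<in> e", OF assms(1) sg e0 _ that])
    fix e f assume e: "e \<in> edges G" "f \<in> edges G" "e \<noteq> f" "e \<inter> f \<noteq> {}" "w \<in> e"
    show "w \<in> f"
    proof (rule ccontr)
      assume "w \<notin> f"
      obtain x where x: "e = {w, x}" by (rule edgeE[OF sg e(1,5)])
      \<comment> \<open>An edge meeting e away from w passes through x, giving x a second edge
        although it is a leaf.\<close>
      then have "x \<in> f" using e \<open>w \<notin> f\<close> by auto
      then have "{e, f} \<subseteq> {e \<in> edges G. x \<in> e}" using e x by auto
      then have "card {e, f} \<le> degree G x"
        unfolding degree_def by (rule card_mono[rotated]) (use fin in auto)
      then show False using e(3) nbr[of x] e(1) x by simp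
    qed
  qed
  have Eeq: "{e \<in> edges G. w \<in> e} = edges G" using all by auto
  obtain y where "e0 = {w, y}" by (rule edgeE[OF sg e0])
  then have "card (edges G) = 3" using nbr[of y] e0 Eeq by (simp add: degree_def)
  then obtain A B C where ABC: "edges G = {A, B, C}" "A \<noteq> B" "A \<noteq> C" "B \<noteq> C"
    by (auto simp: card_3_iff)
  obtain a where a: "A = {w, a}" "w \<noteq> a" by (rule edgeE[OF sg, of A w]) (use ABC all in auto)
  obtain b where b: "B = {w, b}" "w \<noteq> b" by (rule edgeE[OF sg, of B w]) (use ABC all in auto)
  obtain c where c: "C = {w, c}" "w \<noteq> c" by (rule edgeE[OF sg, of C w]) (use ABC all in auto)
  have ne: "a \<noteq> b" "a \<noteq> c" "b \<noteq> c" using ABC a b c by auto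
  let ?g = "(!) [w, a, b, c]"
  have four: "{..<4} = {0, 1, 2, 3::nat}" by auto
  have v: "verts (star_graph 4) = {0, 1, 2, 3}" by (simp add: star_graph_def four)
  have "verts G = \<Union>(edges G)" using Union_edges[OF assms(1) sg] e0 by auto
  also have "\<dots> = ?g ` verts (star_graph 4)"
    using ABC a b c unfolding v by (auto simp: numeral_2_eq_2 numeral_3_eq_3)
  finally have "verts G = ?g ` verts (star_graph 4)" .
  moreover have "inj_on ?g (verts (star_graph 4))"
    unfolding v using a b c ne by (simp add: numeral_2_eq_2 numeral_3_eq_3)
  moreover have "edges G = (`) ?g ` edges (star_graph 4)"
    using ABC a b c by (simp add: edges_star_graph_4 numeral_2_eq_2 numeral_3_eq_3)
  ultimately show ?thesis using graph_iso_iff_image[OF sg simple_star_graph] by blast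
qed

section \<open>Equality in the upper bound\<close>

text \<open>The left side is the equality condition of \<open>SDD_le\<close> for the line graph with
  M = m - 1. Two adjacent edges of line graph degree at least 2 refute it; conversely the line
  graphs of P_3 and P_4 are P_2 and P_3, which satisfy it.\<close>

lemma SDD_line_graph_upper_eq_iff:
  assumes "connected_graph G" "finite_simple_graph G" "card (edges G) = m" "m \<ge> 2"
  shows "(\<forall>e f. {e, f} \<in> edges (line_graph G) \<longrightarrow>
      degree (line_graph G) e = 1 \<and> degree (line_graph G) f = m - 1 \<or>
      degree (line_graph G) e = m - 1 \<and> degree (line_graph G) f = 1) \<longleftrightarrow>
    G \<simeq> path_graph 3 \<or> G \<simeq> path_graph 4" (is "?L \<longleftrightarrow> ?R")
proof
  let ?d = "degree (line_graph G)"
  have sg: "simple_graph G" and fin: "finite (edges G)"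
    using assms(2) finite_edges[OF assms(2)] by (auto simp: finite_simple_graph_def)
  note fl = finite_simple_line_graph[OF assms(2)]
  {
    assume L: ?L
    have deg2: "degree G w \<le> 2" if w: "w \<in> verts G" for w
    proof (rule ccontr)
      assume "\<not> degree G w \<le> 2"
      then have w3: "degree G w \<ge> 3" by simp
      have ge2: "?d e \<ge> 2" if "e \<in> edges G" "w \<in> e" for e
      proof -
        note e = that
        obtain x where x: "e = {w, x}" by (rule edgeE[OF sg e])
        then show ?thesis
          using degree_line_graph[OF assms(2), of w x] degree_pos[OF assms(2), of e x] e w3 by auto
      qed
      \<comment> \<open>Two different edges at w are adjacent in the line graph, and by
        \<open>ge2\<close> neither has degree 1 there.\<close>
      have "\<not> card {e \<in> edges G. w \<in> e} \<le> Suc 0" using w3 by (simp add: degree_def)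
      moreover have "finite {e \<in> edges G. w \<in> e}" using fin by simp
      ultimately obtain e f where "e \<in> edges G" "w \<in> e" "f \<in> edges G" "w \<in> f" "e \<noteq> f"
        by (auto simp: card_le_Suc0_iff_eq)
      moreover from this have "{e, f} \<in> edges (line_graph G)" by (auto simp: line_graph_edge_iff)
      ultimately show False using L ge2 by fastforce
    qed
    have "edges G \<noteq> {}" using assms(3,4) by auto
    from max_degree_2_path_or_cycle[OF assms(1,2) this deg2] assms(3)
    consider "G \<simeq> path_graph (m + 1)" | "m \<ge> 3" "G \<simeq> cycle_graph m" by auto
    then show ?R
    proof cases
      case 1
      then obtain g where g: "inj_on g (verts (path_graph (m + 1)))"
        "edges G = (`) g ` edges (path_graph (m + 1))"
        using graph_iso_iff_image[OF sg simple_path_graph] by blast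
      have "m \<le> 3"
      proof (rule ccontr)
        \<comment> \<open>From four edges on, the second and third edge of the path are adjacent and
          both have line graph degree 2.\<close>
        assume m: "\<not> m \<le> 3"
        have E: "{g i, g (i + 1)} \<in> edges G" if "i < m" for i
          using g(2) that by (auto simp: edges_path_graph image_image)
        have d: "degree G (g i) = 2" if "0 < i" "i < m" for i
          using image_graph_degree[OF simple_path_graph g] degree_path_graph_inner that by simp
        have dl: "?d {g i, g (i + 1)} = 2" if "0 < i" "i + 1 < m" for i
          using degree_line_graph[OF assms(2) E[of i]] d[of i] d[of "i + 1"] that by simp
        have "g 1 \<noteq> g 3"
          using inj_onD[OF g(1), of 1 3] m by auto
        then have "{{g 1, g (1 + 1)}, {g 2, g (2 + 1)}} \<in> edges (line_graph G)"
          using E[of 1] E[of 2] m by (auto simp: line_graph_edge_iff doubleton_eq_iff numeral_2_eq_2 numeral_3_eq_3)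
        with L have "?d {g 1, g (1 + 1)} = 1 \<or> ?d {g 2, g (2 + 1)} = 1" by blast
        then show False using dl[of 1] dl[of 2] m by simp
      qed
      then have "m + 1 = 3 \<or> m + 1 = 4" using assms(4) by auto
      then show ?thesis using 1 by metis
    next
      case 2
      note reg = cycle_line_graph_degree[OF assms(2) 2]
      have "card (edges (line_graph G)) = m"
        using line_graph_2_regular(1)[OF assms(2) reg] assms(3) by simp
      then obtain E where "E \<in> edges (line_graph G)" using 2 by fastforce
      then obtain e f where "{e, f} \<in> edges (line_graph G)" by (metis line_graph_edgeE)
      moreover from this have "?d e = 2" "?d f = 2" using reg by (auto simp: line_graph_edge_iff)
      ultimately have False using L by fastforce
      then show ?thesis ..
    qed
  }
  assume ?R
  then show ?L
  proof
    assume "G \<simeq> path_graph 3"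
    then obtain g where "inj_on g (verts (path_graph 3))" "edges G = (`) g ` edges (path_graph 3)"
      using graph_iso_iff_image[OF sg simple_path_graph] by blast
    from image_graph_card_edges[OF simple_path_graph this] have m: "m = 2"
      using assms(3) by (simp add: card_edges_path_graph)
    have le: "?d e \<le> 1" if "e \<in> edges G" for e
    proof -
      have "?d e \<le> card (edges G - {e})"
        unfolding degree_line_graph_card[OF that] by (rule card_mono) (use fin in auto)
      then show ?thesis using that fin assms(3) m by simp
    qed
    show ?L
    proof (intro allI impI)
      fix e f assume ef: "{e, f} \<in> edges (line_graph G)"
      then have "?d e \<ge> 1" "?d f \<ge> 1" using degree_pos[OF fl ef] by auto
      moreover have "?d e \<le> 1" "?d f \<le> 1" using ef le by (auto simp: line_graph_edge_iff)
      ultimately show "?d e = 1 \<and> ?d f = m - 1 \<or> ?d e = m - 1 \<and> ?d f = 1" using m by auto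
    qed
  next
    assume "G \<simeq> path_graph 4"
    then obtain g where g: "inj_on g (verts (path_graph 4))" "edges G = (`) g ` edges (path_graph 4)"
      using graph_iso_iff_image[OF sg simple_path_graph] by blast
    from image_graph_card_edges[OF simple_path_graph this] have m: "m = 3"
      using assms(3) by (simp add: card_edges_path_graph)
    have "{..<3} = {0, 1, 2::nat}" by auto
    then have E: "edges G = {{g 0, g 1}, {g 1, g 2}, {g 2, g 3}}"
      using g(2) by (simp add: edges_path_graph numeral_3_eq_3 numeral_2_eq_2)
    have d: "degree G (g i) = degree (path_graph 4) i" if "i < 4" for i
      using image_graph_degree[OF simple_path_graph g] that by simp
    have "degree G (g 0) = 1" "degree G (g 1) = 2" "degree G (g 2) = 2" "degree G (g 3) = 1"
      using d degree_path_graph_0[of 4] degree_path_graph_inner[of 1 4]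
        degree_path_graph_inner[of 2 4] degree_path_graph_last[of 4] by auto
    then have dl: "?d {g 0, g 1} = 1" "?d {g 1, g 2} = 2" "?d {g 2, g 3} = 1"
      using degree_line_graph[OF assms(2), of "g 0" "g 1"] degree_line_graph[OF assms(2), of "g 1" "g 2"]
        degree_line_graph[OF assms(2), of "g 2" "g 3"] by (simp_all add: E)
    have "g i = g j \<longleftrightarrow> i = j" if "i < 4" "j < 4" for i j
      using g(1) that by (auto dest: inj_onD)
    then have disj: "{g 0, g 1} \<inter> {g 2, g 3} = {}" by auto
    show ?L
    proof (intro allI impI)
      fix e f assume "{e, f} \<in> edges (line_graph G)"
      then have ef: "e \<in> edges G" "f \<in> edges G" "e \<noteq> f" "e \<inter> f \<noteq> {}"
        by (auto simp: line_graph_edge_iff)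
      then have "e = {g 1, g 2} \<and> f \<in> {{g 0, g 1}, {g 2, g 3}} \<or>
          f = {g 1, g 2} \<and> e \<in> {{g 0, g 1}, {g 2, g 3}}"
        using disj unfolding E by (metis Int_commute insertE singletonD insertI1 insertI2)
      then show "?d e = 1 \<and> ?d f = m - 1 \<or> ?d e = m - 1 \<and> ?d f = 1"
        using dl m by auto
    qed
  qed
qed

text \<open>For m = 1 the classification yields a path on two vertices, whereas the excluded graph
  is phrased as K_2.\<close>

lemma path_graph_2_eq_complete: "path_graph 2 = complete_graph 2"
proof -
  have "edges (complete_graph 2) = {{0, 1}}"
    unfolding complete_graph_def sgraph.sel
  proof (intro equalityI subsetI)
    fix e :: "nat set" assume "e \<in> {{i, j} | i j. i < 2 \<and> j < 2 \<and> i \<noteq> j}"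
    then obtain i j where "e = {i, j}" "i < 2" "j < 2" "i \<noteq> j" by blast
    then show "e \<in> {{0, 1}}" by (auto simp: less_2_cases_iff insert_commute)
  next
    fix e :: "nat set" assume "e \<in> {{0, 1}}"
    then have "e = {0, 1} \<and> (0::nat) < 2 \<and> (1::nat) < 2 \<and> (0::nat) \<noteq> 1" by simp
    then show "e \<in> {{i, j} | i j. i < 2 \<and> j < 2 \<and> i \<noteq> j}" by blast
  qed
  moreover have "edges (path_graph 2) = {{0, 1}}"
    by (auto simp: edges_path_graph lessThan_Suc)
  ultimately show ?thesis
    by (intro sgraph.expand) (simp add: complete_graph_def)
qed

section \<open>Assembling both bounds\<close>

theorem theorem4p1:
  fixes G :: "'a sgraph" and m :: nat
  assumes "finite_simple_graph G"
    and "connected_graph G"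
    and "m = card (edges G)"
    and "m \<ge> 1"
  shows "(\<not> G \<simeq> path_graph (m + 1) \<longrightarrow>
            SDD (line_graph G) \<ge> 2 * real m \<and>
            (SDD (line_graph G) = 2 * real m \<longleftrightarrow>
               G \<simeq> star_graph 4 \<or> (m \<ge> 3 \<and> G \<simeq> cycle_graph m))) \<and>
         (\<not> G \<simeq> complete_graph 2 \<longrightarrow>
            SDD (line_graph G) \<le>
              (1 / 2 * first_Zagreb G - real m) * (real m - 1 + 1 / (real m - 1)) \<and>
            (SDD (line_graph G) =
               (1 / 2 * first_Zagreb G - real m) * (real m - 1 + 1 / (real m - 1)) \<longleftrightarrow>
               G \<simeq> path_graph 3 \<or> G \<simeq> path_graph 4))"
proof (intro conjI impI)
  let ?L = "line_graph G"
  let ?dL = "degree ?L"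
  note fs = assms(1) and conn = assms(2)
  note fl = finite_simple_line_graph[OF fs]
  have sg: "simple_graph G" using fs by (simp add: finite_simple_graph_def)
  have ne: "edges G \<noteq> {}" using assms(3,4) by auto
  have poc: "G \<simeq> path_graph (m + 1) \<or> m \<ge> 3 \<and> G \<simeq> cycle_graph m"
    if "\<And>v. v \<in> verts G \<Longrightarrow> degree G v \<le> 2"
    using max_degree_2_path_or_cycle[OF conn fs ne that] assms(3) by simp
  {
    assume np: "\<not> G \<simeq> path_graph (m + 1)"
    have E: "m \<le> card (edges ?L)"
    proof (cases "\<exists>w\<in>verts G. degree G w \<ge> 3")
      case True
      then show ?thesis using card_edges_le_line_graph[OF conn fs] assms(3) by auto
    next
      case False
      then have "m \<ge> 3" "G \<simeq> cycle_graph m" using poc np by force+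
      from line_graph_2_regular(1)[OF fs cycle_line_graph_degree[OF fs this]]
      show ?thesis using assms(3) by simp
    qed
    show "SDD ?L \<ge> 2 * real m" using SDD_ge(1)[OF fl] E by linarith
    show "SDD ?L = 2 * real m \<longleftrightarrow> G \<simeq> star_graph 4 \<or> (m \<ge> 3 \<and> G \<simeq> cycle_graph m)"
    proof
      assume eq: "SDD ?L = 2 * real m"
      then have cE: "card (edges ?L) = m" using SDD_ge(1)[OF fl] E by linarith
      have deq: "?dL e = ?dL f" if "{e, f} \<in> edges ?L" for e f
        using SDD_ge(2)[OF fl] eq cE that by simp
      obtain e0 where e0: "e0 \<in> edges G" using ne by auto
      have const: "?dL e = ?dL e0" if "e \<in> edges G" for e
      proof (rule connected_edges_induct[where P = "\<lambda>e. ?dL e = ?dL e0", OF conn sg e0 refl _ that])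
        fix e f assume "e \<in> edges G" "f \<in> edges G" "e \<noteq> f" "e \<inter> f \<noteq> {}" "?dL e = ?dL e0"
        then show "?dL f = ?dL e0" using deq[of e f] by (simp add: line_graph_edge_iff)
      qed
      \<comment> \<open>Equality makes the line graph regular, and its m vertices and m edges force
        the common degree to be 2.\<close>
      have "m * ?dL e0 = (\<Sum>e\<in>edges G. ?dL e)" using const assms(3) by simp
      also have "\<dots> = 2 * m" using handshake[OF fl] cE by simp
      finally have reg: "?dL e = 2" if "e \<in> edges G" for e using const[OF that] assms(4) by simp
      show "G \<simeq> star_graph 4 \<or> (m \<ge> 3 \<and> G \<simeq> cycle_graph m)"
      proof (cases "\<exists>w\<in>verts G. degree G w \<ge> 3")
        case True
        then show ?thesis using star_4_if_line_graph_2_regular[OF conn fs _ _ reg] by blast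
      next
        case False
        then show ?thesis using poc np by force
      qed
    next
      assume "G \<simeq> star_graph 4 \<or> (m \<ge> 3 \<and> G \<simeq> cycle_graph m)"
      then have "?dL e = 2" if "e \<in> edges G" for e
        using that star_4_line_graph_degree[OF fs] cycle_line_graph_degree[OF fs] by blast
      then show "SDD ?L = 2 * real m" using line_graph_2_regular(2)[OF fs] assms(3) by simp
    qed
  }
  {
    assume nK: "\<not> G \<simeq> complete_graph 2"
    have m2: "m \<ge> 2"
    proof (rule ccontr)
      assume "\<not> m \<ge> 2"
      then have m1: "m = 1" using assms(4) by simp
      have "degree G v \<le> 2" for v
        using degree_le_card_edges[OF fs, of v] m1 assms(3) by simp
      then have "G \<simeq> path_graph 2" using poc m1 by (auto simp: numeral_2_eq_2)
      then show False using nK path_graph_2_eq_complete by simp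
    qed
    \<comment> \<open>An edge can meet at most the m - 1 other edges.\<close>
    have bound: "?dL e \<le> m - 1" if "e \<in> verts ?L" for e
    proof -
      from that have e: "e \<in> edges G" by simp
      have "?dL e \<le> card (edges G - {e})"
        unfolding degree_line_graph_card[OF e]
        by (rule card_mono) (use finite_edges[OF fs] in auto)
      then show ?thesis using e finite_edges[OF fs] assms(3) by simp
    qed
    have "first_Zagreb G = real (\<Sum>v\<in>verts G. (degree G v)\<^sup>2)" by (simp add: first_Zagreb_def)
    also have "\<dots> = 2 * real (card (edges ?L)) + 2 * real m"
      unfolding card_edges_line_graph[OF fs] assms(3) by simp
    finally have Z: "1 / 2 * first_Zagreb G - real m = real (card (edges ?L))" by linarith
    \<comment> \<open>The truncated subtraction is exact because m is positive.\<close>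
    have M: "real m - 1 = real (m - 1)" using assms(4) by simp
    show "SDD ?L \<le> (1 / 2 * first_Zagreb G - real m) * (real m - 1 + 1 / (real m - 1))"
      unfolding Z M by (rule SDD_le(1)[OF fl bound])
    show "SDD ?L = (1 / 2 * first_Zagreb G - real m) * (real m - 1 + 1 / (real m - 1)) \<longleftrightarrow>
        G \<simeq> path_graph 3 \<or> G \<simeq> path_graph 4"
      unfolding Z M using SDD_le(2)[OF fl bound]
        SDD_line_graph_upper_eq_iff[OF conn fs assms(3)[symmetric] m2] by simp
  }
qed

end
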